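(* Let $y$ be a real number with $\frac12<y<\frac{\sqrt3}{2}$. Then $-\frac12+yi$ is not an eigenvalue of any $4\times4$ permutative doubly stochastic matrix.
   Context: A real matrix is doubly stochastic if its entries are nonnegative and every row and column sums to $1$. A matrix is permutative if every row is a permutation of its first row. A permutative doubly stochastic (PDS) matrix is one that is both. *)

theory Defs
  imports
    Complex_Main
    "HOL-Combinatorics.Permutations"
    "Jordan_Normal_Form.Char_Poly"
begin

definition doubly_stochastic :: "real mat \<Rightarrow> bool" where
  "doubly_stochastic A \<longleftrightarrow>
     (\<forall>i<dim_row A. \<forall>j<dim_col A. 0 \<le> A $$ (i, j)) \<and>
     (\<forall>i<dim_row A. (\<Sum>j<dim_col A. A $$ (i, j)) = 1) \<and>
     (\<forall>j<dim_col A. (\<Sum>i<dim_row A. A $$ (i, j)) = 1)"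

(* The permutation p may depend on the row i; rows are indexed from 0. *)
definition permutative :: "real mat \<Rightarrow> bool" where
  "permutative A \<longleftrightarrow>
     (\<forall>i<dim_row A. \<exists>p. p permutes {..<dim_col A} \<and>
        (\<forall>j<dim_col A. A $$ (i, j) = A $$ (0, p j)))"

definition permutative_doubly_stochastic :: "real mat \<Rightarrow> bool" where
  "permutative_doubly_stochastic A \<longleftrightarrow> permutative A \<and> doubly_stochastic A"

end

theory Submission
  imports Defs
begin

text \<open>
  Let \<open>z = -1/2 + y i\<close> be an eigenvalue of a permutative doubly stochastic matrix \<open>M\<close> of size 4,
  where \<open>1/2 < y < sqrt 3 / 2\<close>.  The argument shows that one entry of \<open>M\<close> dominates, which leaves
  very few possible shapes, and then rules out each shape.

  \<^emph>\<open>A dominant entry.\<close>  By Schur's inequality, the squared Frobenius norm of \<open>M\<close> is at least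
  \<open>1 + 2 |z|^2\<close>, which exceeds 2 as \<open>|z|^2 > 1/2\<close>.  If every entry were at most \<open>1/2\<close>, the sum of
  squares would be at most half the sum of all entries, that is 2.  So some entry \<open>a\<close> exceeds \<open>1/2\<close>.
  Since the rows are rearrangements of each other and the columns sum to 1, the value \<open>a\<close> occurs
  exactly once in every row and every column: its positions form a permutation \<open>\<pi>\<close>.

  \<^emph>\<open>Involutions.\<close>  If \<open>\<pi>\<close> is an involution, then \<open>M = a P + R\<close> with \<open>P\<close> symmetric and the rows and
  columns of \<open>R\<close> summing to \<open>1 - a\<close>.  The numerical range of \<open>P\<close> is real, and that of \<open>R\<close> lies in the
  disc of radius \<open>1 - a < 1/2\<close>, so \<open>|Im z| < 1/2\<close>, a contradiction
  (\<open>Im_eigenvalue_le_of_involution\<close>).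

  \<^emph>\<open>Three- and four-cycles.\<close>  Otherwise \<open>\<pi>\<close> is a 4-cycle or a 3-cycle with a fixed point.  The column
  sums force the three remaining values \<open>b, c, d\<close> into a Latin square with \<open>a\<close>, and there are only
  four such squares for each \<open>\<pi>\<close> (\<open>balanced_rows_cases\<close>).  On the invariant space of vectors with sum
  zero, \<open>M\<close> has three eigenvalues, two of which are \<open>z\<close> and its conjugate.  These add up to -1, so the
  product of \<open>1 + u + w\<close> over the pairs \<open>u, w\<close> of these eigenvalues vanishes.  This product is a cubic
  polynomial in \<open>b, c, d\<close>.  Written in \<open>h = a - b - c - d > 0\<close> and \<open>b, c, d\<close>, and made homogeneous by
  means of \<open>1 = h + 2 b + 2 c + 2 d\<close>, it has nonnegative coefficients in all eight cases.  For the
  4-cycle the term \<open>h^3\<close> occurs and the product is positive.  For the 3-cycle the product vanishes only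
  if \<open>b = c = d = 0\<close>; then \<open>M\<close> is a permutation matrix with \<open>|z| = 1\<close>, and \<open>y = sqrt 3 / 2\<close>.
\<close>

section \<open>Spectral bounds\<close>

lemma eigenvector_sum_zero:
  fixes M :: "'a \<Rightarrow> 'a \<Rightarrow> real" and v :: "'a \<Rightarrow> complex"
  assumes eig: "\<And>i. i \<in> S \<Longrightarrow> (\<Sum>j\<in>S. complex_of_real (M i j) * v j) = z * v i"
    and cols: "\<And>j. j \<in> S \<Longrightarrow> (\<Sum>i\<in>S. M i j) = 1"
    and "z \<noteq> 1"
  shows "(\<Sum>i\<in>S. v i) = 0"
proof -
  have "z * (\<Sum>i\<in>S. v i) = (\<Sum>i\<in>S. \<Sum>j\<in>S. complex_of_real (M i j) * v j)"
    using eig by (simp add: sum_distrib_left)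
  also have "\<dots> = (\<Sum>j\<in>S. complex_of_real (\<Sum>i\<in>S. M i j) * v j)"
    by (subst sum.swap) (simp add: sum_distrib_right)
  also have "\<dots> = (\<Sum>j\<in>S. v j)"
    using cols by simp
  finally show ?thesis using \<open>z \<noteq> 1\<close> by simp
qed

lemma Bessel_inequality_three:
  fixes f p q :: "'a \<Rightarrow> real"
  assumes "finite S" and "S \<noteq> {}"
    and p: "(\<Sum>j\<in>S. p j) = 0" and q: "(\<Sum>j\<in>S. q j) = 0" and pq: "(\<Sum>j\<in>S. p j * q j) = 0"
    and P: "(\<Sum>j\<in>S. (p j)\<^sup>2) = P" "P > 0" and Q: "(\<Sum>j\<in>S. (q j)\<^sup>2) = Q" "Q > 0"
  shows "(\<Sum>j\<in>S. f j)\<^sup>2 / card S + (\<Sum>j\<in>S. f j * p j)\<^sup>2 / P + (\<Sum>j\<in>S. f j * q j)\<^sup>2 / Q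
           \<le> (\<Sum>j\<in>S. (f j)\<^sup>2)"
proof -
  define n where "n = real (card S)"
  have n: "n > 0" using assms by (simp add: n_def card_gt_0_iff)
  define s x y where "s = (\<Sum>j\<in>S. f j)" and "x = (\<Sum>j\<in>S. f j * p j)"
    and "y = (\<Sum>j\<in>S. f j * q j)"
  have "0 \<le> (\<Sum>j\<in>S. (f j - s / n - x / P * p j - y / Q * q j)\<^sup>2)"
    by (intro sum_nonneg) simp
  also have "\<dots> = (\<Sum>j\<in>S. (f j)\<^sup>2 + (s / n)\<^sup>2 + (x / P)\<^sup>2 * (p j)\<^sup>2 + (y / Q)\<^sup>2 * (q j)\<^sup>2
      - 2 * (s / n) * f j - 2 * (x / P) * (f j * p j) - 2 * (y / Q) * (f j * q j)
      + 2 * (s / n) * (x / P) * p j + 2 * (s / n) * (y / Q) * q j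
      + 2 * (x / P) * (y / Q) * (p j * q j))"
    by (intro sum.cong refl) Groebner_Basis.algebra
  also have "\<dots> = (\<Sum>j\<in>S. (f j)\<^sup>2) + n * (s / n)\<^sup>2 + (x / P)\<^sup>2 * P + (y / Q)\<^sup>2 * Q
      - 2 * (s / n) * s - 2 * (x / P) * x - 2 * (y / Q) * y"
    by (simp only: sum.distrib sum_subtractf sum_distrib_left[symmetric] p q pq P(1) Q(1)
        s_def[symmetric] x_def[symmetric] y_def[symmetric] sum_constant n_def[symmetric])
  also have "\<dots> = (\<Sum>j\<in>S. (f j)\<^sup>2) - s\<^sup>2 / n - x\<^sup>2 / P - y\<^sup>2 / Q"
    using n P(2) Q(2) by (simp add: power2_eq_square field_simps)
  finally show ?thesis by (simp add: s_def x_def y_def n_def)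
qed

text \<open>
  Multiplying \<open>v\<close> by a unit scalar multiplies the sum of squares of its entries by the square of that
  scalar.  A suitable scalar makes this sum real, and its imaginary part is twice the inner product of
  the real and imaginary parts.
\<close>
lemma rotate_to_orthogonal_parts:
  fixes v :: "'a \<Rightarrow> complex"
  obtains u where "u \<noteq> 0" and "(\<Sum>j\<in>S. Re (u * v j) * Im (u * v j)) = 0"
proof -
  define w where "w = (\<Sum>j\<in>S. (v j)\<^sup>2)"
  define u where "u = cis (- Arg w / 2)"
  have "u\<^sup>2 = cis (- Arg w)" by (simp add: u_def DeMoivre)
  moreover have "w = rcis (cmod w) (Arg w)" by (simp add: rcis_cmod_Arg)
  ultimately have "u\<^sup>2 * w = complex_of_real (cmod w)"
    by (metis cis_rcis_eq rcis_mult mult_1 add.left_inverse rcis_zero_arg)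
  then have "Im (\<Sum>j\<in>S. (u * v j)\<^sup>2) = 0"
    by (simp add: w_def power_mult_distrib sum_distrib_left)
  moreover have "Im (\<Sum>j\<in>S. (u * v j)\<^sup>2) = 2 * (\<Sum>j\<in>S. Re (u * v j) * Im (u * v j))"
    unfolding Im_sum sum_distrib_left by (intro sum.cong refl) (simp add: power2_eq_square)
  moreover have "u \<noteq> 0" by (simp add: u_def)
  ultimately show ?thesis using that by simp
qed

text \<open>
  A case of Schur's inequality.  After rotation, the real and imaginary parts \<open>p\<close> and \<open>q\<close> of an
  eigenvector are orthogonal to each other and to the constant vector, so Bessel's inequality bounds
  each row of \<open>M\<close> from below.  Summed over the rows, the constant vector contributes 1 and the plane
  of \<open>p\<close> and \<open>q\<close> contributes the squared Frobenius norm of \<open>M\<close> on this plane, which is at least twice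
  its determinant \<open>|z|^2\<close> there.
\<close>
lemma Frobenius_ge_nonreal_eigenvalue:
  fixes M :: "'a \<Rightarrow> 'a \<Rightarrow> real" and v :: "'a \<Rightarrow> complex"
  assumes "finite S"
    and eig: "\<And>i. i \<in> S \<Longrightarrow> (\<Sum>j\<in>S. complex_of_real (M i j) * v j) = z * v i"
    and nz: "\<exists>i\<in>S. v i \<noteq> 0"
    and rows: "\<And>i. i \<in> S \<Longrightarrow> (\<Sum>j\<in>S. M i j) = 1"
    and cols: "\<And>j. j \<in> S \<Longrightarrow> (\<Sum>i\<in>S. M i j) = 1"
    and "Im z \<noteq> 0"
  shows "1 + 2 * (cmod z)\<^sup>2 \<le> (\<Sum>i\<in>S. \<Sum>j\<in>S. (M i j)\<^sup>2)"
proof -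
  obtain u where u: "u \<noteq> 0" "(\<Sum>j\<in>S. Re (u * v j) * Im (u * v j)) = 0"
    using rotate_to_orthogonal_parts .
  define \<alpha> \<beta> p q where "\<alpha> = Re z" and "\<beta> = Im z"
    and "p = (\<lambda>j. Re (u * v j))" and "q = (\<lambda>j. Im (u * v j))"
  define P Q where "P = (\<Sum>j\<in>S. (p j)\<^sup>2)" and "Q = (\<Sum>j\<in>S. (q j)\<^sup>2)"
  have eig': "(\<Sum>j\<in>S. complex_of_real (M i j) * (u * v j)) = z * (u * v i)" if "i \<in> S" for i
    using arg_cong[OF eig[OF that], of "\<lambda>x. u * x"]
    by (simp add: sum_distrib_left ac_simps)
  have Mp: "(\<Sum>j\<in>S. M i j * p j) = \<alpha> * p i - \<beta> * q i" if "i \<in> S" for i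
    using arg_cong[OF eig'[OF that], of Re] by (simp add: \<alpha>_def \<beta>_def p_def q_def del: times_complex.sel) simp
  have Mq: "(\<Sum>j\<in>S. M i j * q j) = \<beta> * p i + \<alpha> * q i" if "i \<in> S" for i
    using arg_cong[OF eig'[OF that], of Im] by (simp add: \<alpha>_def \<beta>_def p_def q_def del: times_complex.sel) simp
  have \<beta>: "\<beta> \<noteq> 0" using \<open>Im z \<noteq> 0\<close> by (simp add: \<beta>_def)
  have "(\<Sum>j\<in>S. u * v j) = 0"
    using eigenvector_sum_zero[OF eig' cols] \<open>Im z \<noteq> 0\<close> by fastforce
  then have sums: "(\<Sum>j\<in>S. p j) = 0" "(\<Sum>j\<in>S. q j) = 0"
    unfolding p_def q_def by (metis Re_sum zero_complex.sel(1), metis Im_sum zero_complex.sel(2))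
  have pq: "(\<Sum>j\<in>S. p j * q j) = 0" using u by (simp add: p_def q_def)
  have not_both: "\<exists>i\<in>S. p i \<noteq> 0 \<or> q i \<noteq> 0"
    using nz u(1) unfolding p_def q_def by (metis complex_eq_iff mult_eq_0_iff zero_complex.sel)
  have "\<not> (\<forall>i\<in>S. p i = 0)"
  proof
    assume 0: "\<forall>i\<in>S. p i = 0"
    then have "\<beta> * q i = 0" if "i \<in> S" for i using Mp[OF that] that by simp
    then show False using not_both 0 \<beta> by simp
  qed
  then have P: "P > 0"
    using \<open>finite S\<close> by (auto simp: P_def intro: sum_pos2)
  have "\<not> (\<forall>i\<in>S. q i = 0)"
  proof
    assume 0: "\<forall>i\<in>S. q i = 0"
    then have "\<beta> * p i = 0" if "i \<in> S" for i using Mq[OF that] that by simp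
    then show False using not_both 0 \<beta> by simp
  qed
  then have Q: "Q > 0"
    using \<open>finite S\<close> by (auto simp: Q_def intro: sum_pos2)
  have S: "S \<noteq> {}" using nz by auto
  have "1 / card S + (\<alpha> * p i - \<beta> * q i)\<^sup>2 / P + (\<beta> * p i + \<alpha> * q i)\<^sup>2 / Q
      \<le> (\<Sum>j\<in>S. (M i j)\<^sup>2)" if "i \<in> S" for i
    using Bessel_inequality_three[OF \<open>finite S\<close> S sums pq P_def[symmetric] P Q_def[symmetric] Q, of "M i"]
    by (simp add: rows[OF that] Mp[OF that] Mq[OF that])
  then have "(\<Sum>i\<in>S. 1 / card S + (\<alpha> * p i - \<beta> * q i)\<^sup>2 / P + (\<beta> * p i + \<alpha> * q i)\<^sup>2 / Q)
      \<le> (\<Sum>i\<in>S. \<Sum>j\<in>S. (M i j)\<^sup>2)"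
    by (rule sum_mono)
  moreover have "(\<Sum>i\<in>S. (\<alpha> * p i - \<beta> * q i)\<^sup>2) = \<alpha>\<^sup>2 * P + \<beta>\<^sup>2 * Q"
  proof -
    have "(\<Sum>i\<in>S. (\<alpha> * p i - \<beta> * q i)\<^sup>2)
        = (\<Sum>i\<in>S. \<alpha>\<^sup>2 * (p i)\<^sup>2 + \<beta>\<^sup>2 * (q i)\<^sup>2 - 2 * \<alpha> * \<beta> * (p i * q i))"
      by (intro sum.cong refl) Groebner_Basis.algebra
    then show ?thesis
      by (simp only: sum.distrib sum_subtractf sum_distrib_left[symmetric] pq P_def Q_def)
  qed
  moreover have "(\<Sum>i\<in>S. (\<beta> * p i + \<alpha> * q i)\<^sup>2) = \<beta>\<^sup>2 * P + \<alpha>\<^sup>2 * Q"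
  proof -
    have "(\<Sum>i\<in>S. (\<beta> * p i + \<alpha> * q i)\<^sup>2)
        = (\<Sum>i\<in>S. \<beta>\<^sup>2 * (p i)\<^sup>2 + \<alpha>\<^sup>2 * (q i)\<^sup>2 + 2 * \<alpha> * \<beta> * (p i * q i))"
      by (intro sum.cong refl) Groebner_Basis.algebra
    then show ?thesis
      by (simp only: sum.distrib sum_subtractf sum_distrib_left[symmetric] pq P_def Q_def)
  qed
  moreover have "(\<Sum>i\<in>S. 1 / real (card S)) = 1"
    using S \<open>finite S\<close> by simp
  ultimately have *: "1 + (\<alpha>\<^sup>2 * P + \<beta>\<^sup>2 * Q) / P + (\<beta>\<^sup>2 * P + \<alpha>\<^sup>2 * Q) / Q
      \<le> (\<Sum>i\<in>S. \<Sum>j\<in>S. (M i j)\<^sup>2)"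
    by (simp add: sum.distrib flip: sum_divide_distrib)
  \<comment> \<open>The trace-determinant inequality for the restriction to the plane of \<open>p\<close> and \<open>q\<close>.\<close>
  have "2 \<le> Q / P + P / Q"
  proof -
    have "0 \<le> (P - Q)\<^sup>2 / (P * Q)" using P Q by simp
    also have "\<dots> = Q / P + P / Q - 2" using P Q by (simp add: field_simps power2_eq_square)
    finally show ?thesis by simp
  qed
  then have "\<beta>\<^sup>2 * 2 \<le> \<beta>\<^sup>2 * (Q / P + P / Q)" by (intro mult_left_mono) auto
  moreover have "1 + (\<alpha>\<^sup>2 * P + \<beta>\<^sup>2 * Q) / P + (\<beta>\<^sup>2 * P + \<alpha>\<^sup>2 * Q) / Q
      = 1 + 2 * \<alpha>\<^sup>2 + \<beta>\<^sup>2 * (Q / P + P / Q)"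
    using P Q by (simp add: field_simps)
  moreover have "(cmod z)\<^sup>2 = \<alpha>\<^sup>2 + \<beta>\<^sup>2" by (simp add: \<alpha>_def \<beta>_def cmod_power2)
  ultimately show ?thesis using * by linarith
qed

text \<open>
  With a unit eigenvector \<open>v\<close>, \<open>Im z\<close> is the imaginary part of the form \<open>v* M v\<close>.  The entries \<open>a\<close>
  sit symmetrically and contribute a real number.  What remains of \<open>M\<close> has row and column sums
  \<open>1 - a\<close>, which bounds its form by \<open>1 - a\<close>.
\<close>
lemma Im_eigenvalue_le_of_involution:
  fixes M :: "'a \<Rightarrow> 'a \<Rightarrow> real" and v :: "'a \<Rightarrow> complex"
  assumes "finite S"
    and eig: "\<And>i. i \<in> S \<Longrightarrow> (\<Sum>j\<in>S. complex_of_real (M i j) * v j) = z * v i"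
    and nz: "\<exists>i\<in>S. v i \<noteq> 0"
    and rows: "\<And>i. i \<in> S \<Longrightarrow> (\<Sum>j\<in>S. M i j) = 1"
    and cols: "\<And>j. j \<in> S \<Longrightarrow> (\<Sum>i\<in>S. M i j) = 1"
    and nonneg: "\<And>i j. i \<in> S \<Longrightarrow> j \<in> S \<Longrightarrow> 0 \<le> M i j"
    and \<pi>: "\<And>i. i \<in> S \<Longrightarrow> \<pi> i \<in> S" "\<And>i. i \<in> S \<Longrightarrow> \<pi> (\<pi> i) = i"
    and a: "\<And>i. i \<in> S \<Longrightarrow> M i (\<pi> i) = a"
  shows "\<bar>Im z\<bar> \<le> 1 - a"
proof -
  define R where "R = (\<lambda>i j. M i j - (if j = \<pi> i then a else 0))"
  have R0: "0 \<le> R i j" if "i \<in> S" "j \<in> S" for i j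
    using nonneg[OF that] a[OF that(1)] by (simp add: R_def)
  have Rrow: "(\<Sum>j\<in>S. R i j) = 1 - a" if "i \<in> S" for i
    using that rows \<pi> \<open>finite S\<close> by (simp add: R_def sum_subtractf)
  have Rcol: "(\<Sum>i\<in>S. R i j) = 1 - a" if "j \<in> S" for j
  proof -
    have "(\<Sum>i\<in>S. if j = \<pi> i then a else 0) = (\<Sum>i\<in>S. if i = \<pi> j then a else 0)"
      using \<pi> that by (intro sum.cong) auto
    then show ?thesis
      using that cols \<pi> \<open>finite S\<close> by (simp add: R_def sum_subtractf)
  qed
  define N where "N = (\<Sum>i\<in>S. (cmod (v i))\<^sup>2)"
  have N: "N > 0" using nz \<open>finite S\<close> by (auto simp: N_def intro: sum_pos2)
  define g where "g = (\<lambda>i j. Im (cnj (v i) * v j))"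
  have g: "\<bar>g i j\<bar> \<le> (cmod (v i))\<^sup>2 / 2 + (cmod (v j))\<^sup>2 / 2" for i j
  proof -
    have "\<bar>g i j\<bar> \<le> cmod (v i) * cmod (v j)"
      unfolding g_def using abs_Im_le_cmod[of "cnj (v i) * v j"] by (simp add: norm_mult)
    also have "\<dots> \<le> (cmod (v i))\<^sup>2 / 2 + (cmod (v j))\<^sup>2 / 2"
      using sum_squares_bound[of "cmod (v i)" "cmod (v j)"] by simp
    finally show ?thesis .
  qed
  have sym: "(\<Sum>i\<in>S. g i (\<pi> i)) = 0"
  proof -
    have "(\<Sum>i\<in>S. g i (\<pi> i)) = (\<Sum>i\<in>S. g (\<pi> i) i)"
      by (rule sum.reindex_bij_witness[of _ \<pi> \<pi>]) (use \<pi> in auto)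
    also have "\<dots> = - (\<Sum>i\<in>S. g i (\<pi> i))"
      by (simp add: g_def algebra_simps flip: sum_negf)
    finally show ?thesis by simp
  qed
  have "complex_of_real N * z = (\<Sum>i\<in>S. cnj (v i) * (z * v i))"
    by (simp add: N_def sum_distrib_left complex_norm_square ac_simps del: of_real_power)
  also have "\<dots> = (\<Sum>i\<in>S. \<Sum>j\<in>S. complex_of_real (M i j) * (cnj (v i) * v j))"
    by (simp add: sum_distrib_left ac_simps flip: eig)
  finally have "N * Im z = (\<Sum>i\<in>S. \<Sum>j\<in>S. M i j * g i j)"
    by (auto simp: g_def dest: arg_cong[of _ _ Im])
  also have "\<dots> = (\<Sum>i\<in>S. (\<Sum>j\<in>S. R i j * g i j) + a * g i (\<pi> i))"
  proof (intro sum.cong refl)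
    fix i assume i: "i \<in> S"
    have "(\<Sum>j\<in>S. M i j * g i j) = (\<Sum>j\<in>S. R i j * g i j + (if j = \<pi> i then a * g i j else 0))"
      by (intro sum.cong) (auto simp: R_def algebra_simps)
    then show "(\<Sum>j\<in>S. M i j * g i j) = (\<Sum>j\<in>S. R i j * g i j) + a * g i (\<pi> i)"
      using i \<pi> \<open>finite S\<close> by (simp add: sum.distrib)
  qed
  also have "\<dots> = (\<Sum>i\<in>S. \<Sum>j\<in>S. R i j * g i j)"
    using sym by (simp add: sum.distrib flip: sum_distrib_left)
  finally have "N * \<bar>Im z\<bar> = \<bar>\<Sum>i\<in>S. \<Sum>j\<in>S. R i j * g i j\<bar>"
    using N by (metis abs_mult abs_of_pos)
  also have "\<dots> \<le> (\<Sum>i\<in>S. \<Sum>j\<in>S. \<bar>R i j * g i j\<bar>)"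
    by (rule order_trans[OF sum_abs]) (intro sum_mono sum_abs)
  also have "\<dots> \<le> (\<Sum>i\<in>S. \<Sum>j\<in>S. R i j * ((cmod (v i))\<^sup>2 / 2 + (cmod (v j))\<^sup>2 / 2))"
    by (intro sum_mono) (auto simp: abs_mult R0 intro!: mult_left_mono g)
  also have "\<dots> = (\<Sum>i\<in>S. (\<Sum>j\<in>S. R i j) * ((cmod (v i))\<^sup>2 / 2))
      + (\<Sum>i\<in>S. \<Sum>j\<in>S. R i j * ((cmod (v j))\<^sup>2 / 2))"
    by (simp only: distrib_left sum.distrib sum_distrib_right)
  also have "(\<Sum>i\<in>S. \<Sum>j\<in>S. R i j * ((cmod (v j))\<^sup>2 / 2))
      = (\<Sum>j\<in>S. (\<Sum>i\<in>S. R i j) * ((cmod (v j))\<^sup>2 / 2))"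
    by (subst sum.swap) (simp only: sum_distrib_right)
  also have "(\<Sum>i\<in>S. (\<Sum>j\<in>S. R i j) * ((cmod (v i))\<^sup>2 / 2))
      + (\<Sum>j\<in>S. (\<Sum>i\<in>S. R i j) * ((cmod (v j))\<^sup>2 / 2)) = N * (1 - a)"
    by (simp add: Rrow Rcol N_def flip: sum_distrib_left sum_divide_distrib)
  finally show ?thesis using N by simp
qed

section \<open>Completing the dominant permutation to a Latin square\<close>

text \<open>
  The completions of a partial Latin square of order 4 whose first row is \<open>(b, a, c, d)\<close> and whose
  other rows are \<open>(x0, x1, a, x3)\<close>, \<open>(y0, y1, y2, a)\<close> and \<open>(a, z1, z2, z3)\<close>.  With the rows in this order
  the positions of \<open>a\<close> form a 4-cycle; with the last two rows exchanged they form a 3-cycle with a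
  fixed point.
\<close>
definition balanced_fillings ::
  "real \<Rightarrow> real \<Rightarrow> real \<Rightarrow> ((real \<times> real \<times> real) \<times> (real \<times> real \<times> real) \<times> (real \<times> real \<times> real)) set" where
  "balanced_fillings b c d =
    {((d, b, c), (c, d, b), (c, d, b)), ((d, c, b), (c, b, d), (d, b, c)),
     ((c, d, b), (d, c, b), (b, d, c)), ((d, c, b), (c, d, b), (b, d, c))}"

lemma mset2_eq_cases:
  assumes "{#x, y#} = {#b, c#}"
  shows "x = b \<and> y = c \<or> x = c \<and> y = b"
proof -
  have "x \<in># {#b, c#}" unfolding assms[symmetric] by simp
  then consider "x = b" | "x = c" by auto
  then show ?thesis
  proof cases
    case 1
    then show ?thesis using assms by simp
  next
    case 2
    then have "add_mset c {#y#} = add_mset c {#b#}"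
      using assms unfolding add_mset_commute[of b c] by simp
    then show ?thesis using 2 by simp
  qed
qed

lemma mset3_eq_cases:
  assumes "{#x, y, z#} = {#b, c, d#}"
  shows
     "(x = b \<and> y = c \<and> z = d) \<or> (x = b \<and> y = d \<and> z = c) \<or>
     (x = c \<and> y = b \<and> z = d) \<or> (x = c \<and> y = d \<and> z = b) \<or>
     (x = d \<and> y = b \<and> z = c) \<or> (x = d \<and> y = c \<and> z = b)"
proof -
  have "x \<in># {#b, c, d#}" unfolding assms[symmetric] by simp
  then consider "x = b" | "x = c" | "x = d" by auto
  then show ?thesis
  proof cases
    case 1
    then have "{#y, z#} = {#c, d#}" using assms by simp
    from mset2_eq_cases[OF this] 1 show ?thesis by blast
  next
    case 2
    then have "add_mset c {#y, z#} = add_mset c {#b, d#}"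
      using assms unfolding add_mset_commute[of b c] by simp
    then have "{#y, z#} = {#b, d#}" by simp
    from mset2_eq_cases[OF this] 2 show ?thesis by blast
  next
    case 3
    then have "add_mset d {#y, z#} = add_mset d {#b, c#}"
      using assms unfolding add_mset_commute[of c d] add_mset_commute[of b d] by simp
    then have "{#y, z#} = {#b, c#}" by simp
    from mset2_eq_cases[OF this] 3 show ?thesis by blast
  qed
qed

lemma two_term_sum_cases:
  fixes b c d :: real
  assumes "x \<in> {b,c,d}" "y \<in> {b,c,d}" "x + y = c + d"
  shows "x = c \<and> y = d \<or> x = d \<and> y = c \<or> x = b \<and> y = b \<and> b + b = c + d"
  using assms by auto

lemma mset3_repeated:
  assumes "{#x, y, z#} = {#b, c, d#}" "x = z"
  shows "x = b \<and> (c = b \<or> d = b) \<or> x = c \<and> (b = c \<or> d = c) \<or> x = d \<and> (b = d \<or> c = d)"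
  using mset3_eq_cases[OF assms(1)] assms by auto

lemma mset3_mem:
  assumes "{#x, y, z#} = {#b, c, d#}"
  shows "x \<in> {b, c, d} \<and> y \<in> {b, c, d} \<and> z \<in> {b, c, d}"
  using mset3_eq_cases[OF assms] by auto

lemma mset3_sum:
  fixes b c d :: real
  assumes "{#x, y, z#} = {#b, c, d#}"
  shows "y = b + c + d - x - z"
  using mset3_eq_cases[OF assms] by auto

text \<open>
  The three equations say that the columns containing \<open>b\<close>, \<open>c\<close> and \<open>d\<close> in the first row have the same
  sum \<open>a + b + c + d\<close> as the rows.  For distinct \<open>b, c, d\<close> a column could still balance without being
  Latin if, say, \<open>b\<close> is the mean of \<open>c\<close> and \<open>d\<close> and fills the whole column, but then another row would
  contain \<open>b\<close> twice.  If some of \<open>b, c, d\<close> coincide, a Latin filling with the same values exists.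
\<close>
lemma balanced_rows_cases:
  fixes b c d :: real
  assumes x: "{#x0, x1, x3#} = {#b, c, d#}" and y: "{#y0, y1, y2#} = {#b, c, d#}"
    and z': "{#z1, z2, z3#} = {#b, c, d#}"
    and eqs: "x0 + y0 = c + d" "y2 + z2 = b + d" "x3 + z3 = b + c"
  shows "((x0, x1, x3), (y0, y1, y2), (z1, z2, z3)) \<in> balanced_fillings b c d"
proof -
  have z: "{#z2, z1, z3#} = {#b, c, d#}" using z' by (simp only: add_mset_commute[of z1 z2])
  note mem = mset3_mem[OF x] mset3_mem[OF y] mset3_mem[OF z]
  note rep = mset3_repeated[OF x] mset3_repeated[OF y] mset3_repeated[OF z]
  note sum = mset3_sum[OF x] mset3_sum[OF y] mset3_sum[OF z]
  have 1: "x0 = c \<and> y0 = d \<or> x0 = d \<and> y0 = c \<or> x0 = b \<and> y0 = b \<and> b + b = c + d"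
    using two_term_sum_cases[OF _ _ eqs(1)] mem by simp
  have 2: "y2 = b \<and> z2 = d \<or> y2 = d \<and> z2 = b \<or> y2 = c \<and> z2 = c \<and> c + c = b + d"
    using two_term_sum_cases[of y2 c b d z2] mem eqs(2) by (simp add: insert_commute)
  have 3: "x3 = b \<and> z3 = c \<or> x3 = c \<and> z3 = b \<or> x3 = d \<and> z3 = d \<and> d + d = b + c"
    using two_term_sum_cases[of x3 d b c z3] mem eqs(3) by (simp add: insert_commute)
  have R:
    "((x0, x3), (y0, y2), (z2, z3)) \<in>
      {((d, c), (c, b), (d, b)), ((d, b), (c, d), (b, c)), ((c, b), (d, b), (d, c)), ((d, b), (c, b), (d, c))}"
  proof -
    \<comment> \<open>The ties among \<open>b, c, d\<close> decide which of the alternatives in 1, 2 and 3 can occur.\<close>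
    consider "b = c" "b = d" | "b = c" "b \<noteq> d" | "b = d" "b \<noteq> c" | "c = d" "b \<noteq> c" | "b \<noteq> c" "b \<noteq> d" "c \<noteq> d" by blast
    then show ?thesis
    proof cases
      case 1 then show ?thesis using mem by simp
    next
      case c: 2
      have "x0 = c \<and> y0 = d \<or> x0 = d \<and> y0 = c" "y2 = b \<and> z2 = d \<or> y2 = d \<and> z2 = b" "x3 = b \<and> z3 = b"
        using 1 2 3 c by auto
      then show ?thesis using rep c by auto
    next
      case c: 3
      have "x0 = c \<and> y0 = d \<or> x0 = d \<and> y0 = c" "y2 = b \<and> z2 = b" "x3 = b \<and> z3 = c \<or> x3 = c \<and> z3 = b"
        using 1 2 3 c by auto
      then show ?thesis using rep c by auto
    next
      case c: 4
      have "x0 = c \<and> y0 = c" "y2 = b \<and> z2 = d \<or> y2 = d \<and> z2 = b" "x3 = b \<and> z3 = c \<or> x3 = c \<and> z3 = b"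
        using 1 2 3 c by auto
      then show ?thesis using rep c by auto
    next
      case c: 5
      have "x0 \<noteq> x3" "y0 \<noteq> y2" "z2 \<noteq> z3" using c rep by auto
      then show ?thesis using c 1 2 3 by (elim disjE conjE) simp_all
    qed
  qed
  then show ?thesis unfolding sum balanced_fillings_def by (elim insertE emptyE) simp_all
qed

section \<open>Eigenvalue pairs of a matrix of order 3\<close>

definition trace3 :: "real \<Rightarrow> real \<Rightarrow> real \<Rightarrow> real \<Rightarrow> real \<Rightarrow> real \<Rightarrow> real \<Rightarrow> real \<Rightarrow> real \<Rightarrow> real" where
  "trace3 x11 x12 x13 x21 x22 x23 x31 x32 x33 = x11 + x22 + x33"

definition minors3 :: "real \<Rightarrow> real \<Rightarrow> real \<Rightarrow> real \<Rightarrow> real \<Rightarrow> real \<Rightarrow> real \<Rightarrow> real \<Rightarrow> real \<Rightarrow> real" where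
  "minors3 x11 x12 x13 x21 x22 x23 x31 x32 x33 =
     (x11 * x22 - x12 * x21) + (x11 * x33 - x13 * x31) + (x22 * x33 - x23 * x32)"

definition det3 :: "'a::comm_ring_1 \<Rightarrow> 'a \<Rightarrow> 'a \<Rightarrow> 'a \<Rightarrow> 'a \<Rightarrow> 'a \<Rightarrow> 'a \<Rightarrow> 'a \<Rightarrow> 'a \<Rightarrow> 'a" where
  "det3 x11 x12 x13 x21 x22 x23 x31 x32 x33 =
     x11 * (x22 * x33 - x23 * x32) - x12 * (x21 * x33 - x23 * x31) + x13 * (x21 * x32 - x22 * x31)"

lemma det3_zero_of_kernel:
  fixes u v w :: "'a::idom"
  assumes "x11 * u + x12 * v + x13 * w = 0" "x21 * u + x22 * v + x23 * w = 0"
    "x31 * u + x32 * v + x33 * w = 0" and "u \<noteq> 0 \<or> v \<noteq> 0 \<or> w \<noteq> 0"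
  shows "det3 x11 x12 x13 x21 x22 x23 x31 x32 x33 = 0" (is "?D = 0")
proof -
  have "?D * u = 0" "?D * v = 0" "?D * w = 0"
    using assms(1-3) unfolding det3_def by Groebner_Basis.algebra+
  then show ?thesis using assms(4) by auto
qed

lemma det3_minus_scalar:
  fixes z :: complex
  shows "det3 (complex_of_real x11 - z) (of_real x12) (of_real x13)
      (of_real x21) (of_real x22 - z) (of_real x23)
      (of_real x31) (of_real x32) (of_real x33 - z) =
    - (z ^ 3) + of_real (trace3 x11 x12 x13 x21 x22 x23 x31 x32 x33) * z\<^sup>2
    - of_real (minors3 x11 x12 x13 x21 x22 x23 x31 x32 x33) * z
    + of_real (det3 x11 x12 x13 x21 x22 x23 x31 x32 x33)"
  unfolding det3_def trace3_def minors3_def of_real_add of_real_diff of_real_mult by Groebner_Basis.algebra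

text \<open>
  Here \<open>e1\<close>, \<open>e2\<close>, \<open>e3\<close> are the elementary symmetric functions of the three roots.  As \<open>z\<close> and its
  conjugate add up to -1, the third root is \<open>1 + e1\<close>, and the squared modulus of \<open>z\<close> is \<open>1 + e1 + e2\<close>.
\<close>
lemma cubic_root_real_part_half:
  fixes e1 e2 e3 y :: real
  assumes "- (z ^ 3) + complex_of_real e1 * z\<^sup>2 - of_real e2 * z + of_real e3 = 0"
    and z: "z = - (1 / 2) + complex_of_real y * \<i>" and "y \<noteq> 0"
  shows "1 + e1 + e2 = 1 / 4 + y\<^sup>2" and "e3 = (1 + e1) * (1 + e1 + e2)"
proof -
  define N where "N = 1 / 4 + y\<^sup>2"
  have z2: "z\<^sup>2 = - z - complex_of_real N"
    by (simp add: z N_def complex_eq_iff power2_eq_square algebra_simps)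
  then have "z ^ 3 = (1 - complex_of_real N) * z + of_real N" by Groebner_Basis.algebra
  with assms(1) z2
  have *: "of_real (N - 1 - e1 - e2) * z + complex_of_real (e3 - N - e1 * N) = 0"
    unfolding of_real_diff of_real_mult of_real_1 by Groebner_Basis.algebra
  have "Im (of_real s * z + of_real t) = s * y" for s t
    by (simp add: z)
  with * have "(N - 1 - e1 - e2) * y = 0" by (metis zero_complex.sel(2))
  then have 1: "N - 1 - e1 - e2 = 0" using \<open>y \<noteq> 0\<close> by simp
  then have "e3 = N + e1 * N" using * by (simp flip: of_real_add of_real_mult of_real_diff)
  with 1 show "1 + e1 + e2 = 1 / 4 + y\<^sup>2" "e3 = (1 + e1) * (1 + e1 + e2)"
    by (auto simp: N_def algebra_simps)
qed

text \<open>
  The product of \<open>1 + u + w\<close> over the three pairs of eigenvalues \<open>u, w\<close> of the matrix.  Since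
  \<open>1 + u + w = 1 + e1 - t\<close> for the remaining eigenvalue \<open>t\<close>, it is the value at \<open>1 + e1\<close> of the
  characteristic polynomial, which equals the formula below.
\<close>
definition pair_sum_product ::
  "real \<Rightarrow> real \<Rightarrow> real \<Rightarrow> real \<Rightarrow> real \<Rightarrow> real \<Rightarrow> real \<Rightarrow> real \<Rightarrow> real \<Rightarrow> real" where
  "pair_sum_product x11 x12 x13 x21 x22 x23 x31 x32 x33 =
     (1 + trace3 x11 x12 x13 x21 x22 x23 x31 x32 x33) *
     (1 + trace3 x11 x12 x13 x21 x22 x23 x31 x32 x33 + minors3 x11 x12 x13 x21 x22 x23 x31 x32 x33)
     - det3 x11 x12 x13 x21 x22 x23 x31 x32 x33"

section \<open>Positivity for the eight Latin squares\<close>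

text \<open>
  In coordinates that omit the last entry, the action of a matrix on vectors with sum zero is obtained by
  subtracting the last column from the others and deleting the last row.  In the proofs, \<open>?R\<close> is
  what remains of the homogeneous expansion in \<open>h, b, c, d\<close> after the lower bound is split off; all
  its coefficients are positive.
\<close>
lemma pair_sum_product_four_cycle:
  assumes fill: "((x0, x1, x3), (y0, y1, y2), (z1, z2, z3)) \<in> balanced_fillings b c d"
    and sum: "a + b + c + d = 1" and big: "b + c + d < a"
    and nonneg: "0 \<le> b" "0 \<le> c" "0 \<le> d"
  shows "0 < pair_sum_product (b - d) (a - d) (c - d) (x0 - x3) (x1 - x3) (a - x3)
        (y0 - a) (y1 - a) (y2 - a)"
proof -
  define h where "h = a - b - c - d"
  have h: "0 < h" using big by (simp add: h_def)
  have a: "a = h + b + c + d" by (simp add: h_def)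
  have one: "1 = h + 2 * b + 2 * c + 2 * d" using sum by (simp add: h_def)
  note posi = add_nonneg_nonneg mult_nonneg_nonneg zero_le_power
  consider
    (1) "x0 = d" "x1 = b" "x3 = c" "y0 = c" "y1 = d" "y2 = b" "z1 = c" "z2 = d" "z3 = b"
  | (2) "x0 = d" "x1 = c" "x3 = b" "y0 = c" "y1 = b" "y2 = d" "z1 = d" "z2 = b" "z3 = c"
  | (3) "x0 = c" "x1 = d" "x3 = b" "y0 = d" "y1 = c" "y2 = b" "z1 = b" "z2 = d" "z3 = c"
  | (4) "x0 = d" "x1 = c" "x3 = b" "y0 = c" "y1 = d" "y2 = b" "z1 = b" "z2 = d" "z3 = c"
    using fill unfolding balanced_fillings_def by auto
  then show ?thesis
  proof cases
    case 1
    let ?R = "6 * h\<^sup>2 * b + 2 * h\<^sup>2 * c + 2 * h\<^sup>2 * d + 18 * h * b\<^sup>2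
         + 16 * h * b * c + 4 * h * b * d + 2 * h * c\<^sup>2 + 4 * h * c * d
         + 40 * b ^ 3 + 32 * b\<^sup>2 * c + 20 * b\<^sup>2 * d + 8 * b * c\<^sup>2
         + 16 * b * c * d + 4 * c\<^sup>2 * d"
    have "pair_sum_product (b - d) (a - d) (c - d) (x0 - x3) (x1 - x3) (a - x3)
        (y0 - a) (y1 - a) (y2 - a) = h ^ 3 + ?R"
      unfolding pair_sum_product_def trace3_def minors3_def det3_def 1 using a one by Groebner_Basis.algebra
    moreover have "0 \<le> ?R" using h nonneg by (intro posi) auto
    ultimately show ?thesis using zero_less_power[OF h, of 3] by linarith
  next
    case 2
    let ?R = "3 * h\<^sup>2 * b + 4 * h\<^sup>2 * c + 3 * h\<^sup>2 * d + 4 * h * b\<^sup>2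
         + 12 * h * b * c + 4 * h * b * d + 8 * h * c\<^sup>2 + 12 * h * c * d
         + 4 * h * d\<^sup>2 + 2 * b ^ 3 + 16 * b\<^sup>2 * c + 6 * b\<^sup>2 * d
         + 20 * b * c\<^sup>2 + 24 * b * c * d + 6 * b * d\<^sup>2 + 8 * c ^ 3
         + 20 * c\<^sup>2 * d + 16 * c * d\<^sup>2 + 2 * d ^ 3"
    have "pair_sum_product (b - d) (a - d) (c - d) (x0 - x3) (x1 - x3) (a - x3)
        (y0 - a) (y1 - a) (y2 - a) = h ^ 3 + ?R"
      unfolding pair_sum_product_def trace3_def minors3_def det3_def 2 using a one by Groebner_Basis.algebra
    moreover have "0 \<le> ?R" using h nonneg by (intro posi) auto
    ultimately show ?thesis using zero_less_power[OF h, of 3] by linarith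
  next
    case 3
    let ?R = "4 * h\<^sup>2 * b + 3 * h\<^sup>2 * c + 3 * h\<^sup>2 * d + 8 * h * b\<^sup>2
         + 12 * h * b * c + 12 * h * b * d + 4 * h * c\<^sup>2 + 4 * h * c * d
         + 4 * h * d\<^sup>2 + 8 * b ^ 3 + 20 * b\<^sup>2 * c + 20 * b\<^sup>2 * d
         + 16 * b * c\<^sup>2 + 24 * b * c * d + 16 * b * d\<^sup>2 + 2 * c ^ 3
         + 6 * c\<^sup>2 * d + 6 * c * d\<^sup>2 + 2 * d ^ 3"
    have "pair_sum_product (b - d) (a - d) (c - d) (x0 - x3) (x1 - x3) (a - x3)
        (y0 - a) (y1 - a) (y2 - a) = h ^ 3 + ?R"
      unfolding pair_sum_product_def trace3_def minors3_def det3_def 3 using a one by Groebner_Basis.algebra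
    moreover have "0 \<le> ?R" using h nonneg by (intro posi) auto
    ultimately show ?thesis using zero_less_power[OF h, of 3] by linarith
  next
    case 4
    let ?R = "4 * h\<^sup>2 * b + 4 * h\<^sup>2 * c + 2 * h\<^sup>2 * d + 8 * h * b\<^sup>2
         + 20 * h * b * c + 4 * h * b * d + 8 * h * c\<^sup>2 + 4 * h * c * d + 8 * b ^ 3
         + 32 * b\<^sup>2 * c + 8 * b\<^sup>2 * d + 32 * b * c\<^sup>2 + 24 * b * c * d
         + 8 * c ^ 3 + 8 * c\<^sup>2 * d"
    have "pair_sum_product (b - d) (a - d) (c - d) (x0 - x3) (x1 - x3) (a - x3)
        (y0 - a) (y1 - a) (y2 - a) = h ^ 3 + ?R"
      unfolding pair_sum_product_def trace3_def minors3_def det3_def 4 using a one by Groebner_Basis.algebra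
    moreover have "0 \<le> ?R" using h nonneg by (intro posi) auto
    ultimately show ?thesis using zero_less_power[OF h, of 3] by linarith
  qed
qed

text \<open>
  The bound must allow equality at \<open>b = c = d = 0\<close>, where the matrix is the permutation matrix of a
  3-cycle, which does have two eigenvalues with sum -1.
\<close>
lemma pair_sum_product_three_cycle:
  assumes fill: "((x0, x1, x3), (y0, y1, y2), (z1, z2, z3)) \<in> balanced_fillings b c d"
    and sum: "a + b + c + d = 1" and big: "b + c + d < a"
    and nonneg: "0 \<le> b" "0 \<le> c" "0 \<le> d"
  shows "(a - b - c - d)\<^sup>2 * (b + c + d) \<le> pair_sum_product (b - d) (a - d) (c - d) (x0 - x3) (x1 - x3) (a - x3)
        (a - z3) (z1 - z3) (z2 - z3)"
proof -
  define h where "h = a - b - c - d"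
  have h: "0 < h" using big by (simp add: h_def)
  have a: "a = h + b + c + d" by (simp add: h_def)
  have one: "1 = h + 2 * b + 2 * c + 2 * d" using sum by (simp add: h_def)
  note posi = add_nonneg_nonneg mult_nonneg_nonneg zero_le_power
  consider
    (1) "x0 = d" "x1 = b" "x3 = c" "y0 = c" "y1 = d" "y2 = b" "z1 = c" "z2 = d" "z3 = b"
  | (2) "x0 = d" "x1 = c" "x3 = b" "y0 = c" "y1 = b" "y2 = d" "z1 = d" "z2 = b" "z3 = c"
  | (3) "x0 = c" "x1 = d" "x3 = b" "y0 = d" "y1 = c" "y2 = b" "z1 = b" "z2 = d" "z3 = c"
  | (4) "x0 = d" "x1 = c" "x3 = b" "y0 = c" "y1 = d" "y2 = b" "z1 = b" "z2 = d" "z3 = c"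
    using fill unfolding balanced_fillings_def by auto
  then show ?thesis
  proof cases
    case 1
    let ?R = "6 * h\<^sup>2 * b + 3 * h\<^sup>2 * d + 22 * h * b\<^sup>2 + 20 * h * b * c
         + 32 * h * b * d + 2 * h * c\<^sup>2 + 8 * h * c * d + 12 * h * d\<^sup>2
         + 18 * b ^ 3 + 30 * b\<^sup>2 * c + 44 * b\<^sup>2 * d + 14 * b * c\<^sup>2
         + 40 * b * c * d + 36 * b * d\<^sup>2 + 2 * c ^ 3 + 4 * c\<^sup>2 * d
         + 12 * c * d\<^sup>2 + 8 * d ^ 3"
    have "pair_sum_product (b - d) (a - d) (c - d) (x0 - x3) (x1 - x3) (a - x3)
        (a - z3) (z1 - z3) (z2 - z3) = h\<^sup>2 * (b + c + d) + ?R"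
      unfolding pair_sum_product_def trace3_def minors3_def det3_def 1 using a one by Groebner_Basis.algebra
    moreover have "0 \<le> ?R" using h nonneg by (intro posi) auto
    ultimately show ?thesis unfolding h_def[symmetric] by linarith
  next
    case 2
    let ?R = "6 * h\<^sup>2 * b + 3 * h\<^sup>2 * c + 22 * h * b\<^sup>2 + 32 * h * b * c
         + 20 * h * b * d + 12 * h * c\<^sup>2 + 8 * h * c * d + 2 * h * d\<^sup>2
         + 18 * b ^ 3 + 44 * b\<^sup>2 * c + 30 * b\<^sup>2 * d + 36 * b * c\<^sup>2
         + 40 * b * c * d + 14 * b * d\<^sup>2 + 8 * c ^ 3 + 12 * c\<^sup>2 * d
         + 4 * c * d\<^sup>2 + 2 * d ^ 3"
    have "pair_sum_product (b - d) (a - d) (c - d) (x0 - x3) (x1 - x3) (a - x3)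
        (a - z3) (z1 - z3) (z2 - z3) = h\<^sup>2 * (b + c + d) + ?R"
      unfolding pair_sum_product_def trace3_def minors3_def det3_def 2 using a one by Groebner_Basis.algebra
    moreover have "0 \<le> ?R" using h nonneg by (intro posi) auto
    ultimately show ?thesis unfolding h_def[symmetric] by linarith
  next
    case 3
    let ?R = "3 * h\<^sup>2 * b + 6 * h\<^sup>2 * d + 12 * h * b\<^sup>2 + 8 * h * b * c
         + 32 * h * b * d + 2 * h * c\<^sup>2 + 20 * h * c * d + 22 * h * d\<^sup>2
         + 8 * b ^ 3 + 12 * b\<^sup>2 * c + 36 * b\<^sup>2 * d + 4 * b * c\<^sup>2
         + 40 * b * c * d + 44 * b * d\<^sup>2 + 2 * c ^ 3 + 14 * c\<^sup>2 * d
         + 30 * c * d\<^sup>2 + 18 * d ^ 3"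
    have "pair_sum_product (b - d) (a - d) (c - d) (x0 - x3) (x1 - x3) (a - x3)
        (a - z3) (z1 - z3) (z2 - z3) = h\<^sup>2 * (b + c + d) + ?R"
      unfolding pair_sum_product_def trace3_def minors3_def det3_def 3 using a one by Groebner_Basis.algebra
    moreover have "0 \<le> ?R" using h nonneg by (intro posi) auto
    ultimately show ?thesis unfolding h_def[symmetric] by linarith
  next
    case 4
    let ?R = "3 * h\<^sup>2 * b + 3 * h\<^sup>2 * c + 3 * h\<^sup>2 * d + 12 * h * b\<^sup>2
         + 20 * h * b * c + 20 * h * b * d + 12 * h * c\<^sup>2 + 20 * h * c * d
         + 12 * h * d\<^sup>2 + 8 * b ^ 3 + 24 * b\<^sup>2 * c + 24 * b\<^sup>2 * d
         + 24 * b * c\<^sup>2 + 40 * b * c * d + 24 * b * d\<^sup>2 + 8 * c ^ 3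
         + 24 * c\<^sup>2 * d + 24 * c * d\<^sup>2 + 8 * d ^ 3"
    have "pair_sum_product (b - d) (a - d) (c - d) (x0 - x3) (x1 - x3) (a - x3)
        (a - z3) (z1 - z3) (z2 - z3) = h\<^sup>2 * (b + c + d) + ?R"
      unfolding pair_sum_product_def trace3_def minors3_def det3_def 4 using a one by Groebner_Basis.algebra
    moreover have "0 \<le> ?R" using h nonneg by (intro posi) auto
    ultimately show ?thesis unfolding h_def[symmetric] by linarith
  qed
qed

section \<open>Matrices of order 4\<close>

text \<open>
  Listing the indices along the cycle makes \<open>(b, a, c, d)\<close> the first row and turns the rows into the
  partial Latin square of \<open>balanced_fillings\<close>; for the 3-cycle the rows \<open>r\<close> and \<open>s\<close> exchange their
  places in it.
\<close>
lemma dominant_three_or_four_cycle_contradiction: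
  fixes M :: "'a \<Rightarrow> 'a \<Rightarrow> real" and v :: "'a \<Rightarrow> complex" and y :: real
  assumes S: "S = {p, q, r, s}" "distinct [p, q, r, s]"
    and eig: "\<And>i. i \<in> S \<Longrightarrow> (\<Sum>j\<in>S. complex_of_real (M i j) * v j) = z * v i"
    and nz: "\<exists>i\<in>S. v i \<noteq> 0"
    and rows: "\<And>i. i \<in> S \<Longrightarrow> (\<Sum>j\<in>S. M i j) = 1"
    and cols: "\<And>j. j \<in> S \<Longrightarrow> (\<Sum>i\<in>S. M i j) = 1"
    and nonneg: "\<And>i j. i \<in> S \<Longrightarrow> j \<in> S \<Longrightarrow> 0 \<le> M i j"
    and perm: "\<And>i. i \<in> S \<Longrightarrow> image_mset (M i) (mset_set S) = image_mset (M p) (mset_set S)"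
    and a: "M p q = a" "M q r = a"
    and cycle: "(M r s = a \<and> M s p = a) \<or> (M r p = a \<and> M s s = a)"
    and big: "1 / 2 < a"
    and z: "z = - (1 / 2) + complex_of_real y * \<i>" and y: "y \<noteq> 0" "y\<^sup>2 < 3 / 4"
  shows False
proof -
  define b c d where "b = M p p" and "c = M p r" and "d = M p s"
  note bcd = b_def[symmetric] c_def[symmetric] d_def[symmetric]
  have sum_S: "sum f S = f p + f q + f r + f s" for f :: "'a \<Rightarrow> 'b::comm_monoid_add"
    using S(2) by (simp add: S(1) ac_simps)
  have row_mset: "{#M i p, M i q, M i r, M i s#} = {#b, a, c, d#}" if "i \<in> S" for i
    using perm[OF that] S(2) by (simp add: S(1) bcd a)
  have inS: "p \<in> S" "q \<in> S" "r \<in> S" "s \<in> S" by (auto simp: S(1))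
  have sum: "a + b + c + d = 1" using rows[of p] inS by (simp add: sum_S bcd a)
  have nn: "0 \<le> b" "0 \<le> c" "0 \<le> d" using nonneg inS by (auto simp: b_def c_def d_def)
  have dom: "b + c + d < a" using sum big by simp
  have x: "{#M q p, M q q, M q s#} = {#b, c, d#}"
    using row_mset[OF inS(2)] a by (simp add: add_mset_commute)
  note col = cols[unfolded sum_S, OF inS(1)] cols[unfolded sum_S, OF inS(3)] cols[unfolded sum_S, OF inS(4)]

  have v_sum: "v p + v q + v r + v s = 0"
    using eigenvector_sum_zero[OF eig cols] y(1) by (simp add: sum_S z complex_eq_iff)
  \<comment> \<open>Eliminating \<open>v s\<close> reduces the eigenvalue equation to the three coordinates \<open>p, q, r\<close>.\<close>
  then have vs: "v s = - (v p + v q + v r)" by Groebner_Basis.algebra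
  have "v p \<noteq> 0 \<or> v q \<noteq> 0 \<or> v r \<noteq> 0" using nz vs by (auto simp: S(1))
  moreover have red: "complex_of_real (M i p - M i s) * v p + complex_of_real (M i q - M i s) * v q
      + complex_of_real (M i r - M i s) * v r = z * v i" if "i \<in> S" for i
    using eig[OF that] unfolding sum_S vs of_real_diff by Groebner_Basis.algebra
  ultimately have "det3 (complex_of_real (M p p - M p s) - z) (of_real (M p q - M p s)) (of_real (M p r - M p s))
      (of_real (M q p - M q s)) (of_real (M q q - M q s) - z) (of_real (M q r - M q s))
      (of_real (M r p - M r s)) (of_real (M r q - M r s)) (of_real (M r r - M r s) - z) = 0"
  proof (intro det3_zero_of_kernel[where u = "v p" and v = "v q" and w = "v r"])
    show "(complex_of_real (M p p - M p s) - z) * v p + of_real (M p q - M p s) * v q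
        + of_real (M p r - M p s) * v r = 0"
      using red[OF inS(1)] by Groebner_Basis.algebra
    show "of_real (M q p - M q s) * v p + (complex_of_real (M q q - M q s) - z) * v q
        + of_real (M q r - M q s) * v r = 0"
      using red[OF inS(2)] by Groebner_Basis.algebra
    show "of_real (M r p - M r s) * v p + of_real (M r q - M r s) * v q
        + (complex_of_real (M r r - M r s) - z) * v r = 0"
      using red[OF inS(3)] by Groebner_Basis.algebra
  qed
  note cubic = cubic_root_real_part_half[OF this[unfolded det3_minus_scalar] z y(1)]

  show False
    using cycle
  proof
    assume C: "M r s = a \<and> M s p = a"
    have "{#M r p, M r q, M r r#} = {#b, c, d#}"
      using row_mset[OF inS(3)] C by (simp add: add_mset_commute)
    moreover have "{#M s q, M s r, M s s#} = {#b, c, d#}"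
      using row_mset[OF inS(4)] C by (simp add: add_mset_commute)
    ultimately have "((M q p, M q q, M q s), (M r p, M r q, M r r), (M s q, M s r, M s s))
        \<in> balanced_fillings b c d"
      using x col sum C a by (intro balanced_rows_cases) (auto simp: bcd)
    from pair_sum_product_four_cycle[OF this sum dom nn] cubic(2)
    show False using C a by (simp add: pair_sum_product_def bcd)
  next
    assume C: "M r p = a \<and> M s s = a"
    have "{#M r q, M r r, M r s#} = {#b, c, d#}"
      using row_mset[OF inS(3)] C by (simp add: add_mset_commute)
    moreover have "{#M s p, M s q, M s r#} = {#b, c, d#}"
      using row_mset[OF inS(4)] C by (simp add: add_mset_commute)
    ultimately have fill: "((M q p, M q q, M q s), (M s p, M s q, M s r), (M r q, M r r, M r s))
        \<in> balanced_fillings b c d"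
      using x col sum C a by (intro balanced_rows_cases) (auto simp: bcd)
    from pair_sum_product_three_cycle[OF this sum dom nn] cubic(2)
    have "(a - b - c - d)\<^sup>2 * (b + c + d) \<le> 0" using C a by (simp add: pair_sum_product_def bcd)
    then have "b + c + d \<le> 0"
      using dom by (simp add: mult_le_0_iff)
    then have 0: "b = 0" "c = 0" "d = 0" using nn by auto
    then have "a = 1" using sum by simp
    \<comment> \<open>Now \<open>1 + e1 + e2 = 1\<close>, whereas \<open>1 / 4 + y\<^sup>2 < 1\<close>.\<close>
    then show False
      using cubic(1) y(2) C a fill by (simp add: 0 bcd balanced_fillings_def trace3_def minors3_def)
  qed
qed

text \<open>
  The dominant entry exists because \<open>|z|^2 > 1/2\<close>.  If the permutation of its positions is not an
  involution, following it from an index \<open>p\<close> that it does not return to after two steps gives three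
  distinct indices \<open>p, q, r\<close>, and the fourth index \<open>s\<close> either lies on the same cycle or is fixed.
\<close>
lemma permutative_four_no_eigenvalue:
  fixes M :: "'a \<Rightarrow> 'a \<Rightarrow> real" and v :: "'a \<Rightarrow> complex" and y :: real
  assumes S: "card S = 4"
    and eig: "\<And>i. i \<in> S \<Longrightarrow> (\<Sum>j\<in>S. complex_of_real (M i j) * v j) = z * v i"
    and rows: "\<And>i. i \<in> S \<Longrightarrow> (\<Sum>j\<in>S. M i j) = 1"
    and cols: "\<And>j. j \<in> S \<Longrightarrow> (\<Sum>i\<in>S. M i j) = 1"
    and nonneg: "\<And>i j. i \<in> S \<Longrightarrow> j \<in> S \<Longrightarrow> 0 \<le> M i j"
    and perm: "\<And>i k. i \<in> S \<Longrightarrow> k \<in> S \<Longrightarrow>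
      image_mset (M i) (mset_set S) = image_mset (M k) (mset_set S)"
    and z: "z = - (1 / 2) + complex_of_real y * \<i>" and y: "1 / 2 < y" "y\<^sup>2 < 3 / 4"
    and "i \<in> S"
  shows "v i = 0"
proof (rule ccontr)
  assume "v i \<noteq> 0"
  with \<open>i \<in> S\<close> have nz: "\<exists>i\<in>S. v i \<noteq> 0" by blast
  have fin: "finite S" using S by (simp add: card_ge_0_finite)
  have "\<exists>i\<in>S. \<exists>j\<in>S. 1 / 2 < M i j"
  proof (rule ccontr)
    assume "\<not> ?thesis"
    then have "(M i j)\<^sup>2 \<le> 1 / 2 * M i j" if "i \<in> S" "j \<in> S" for i j
      unfolding power2_eq_square using that nonneg by (intro mult_right_mono) (auto simp: not_less)
    then have "(\<Sum>i\<in>S. \<Sum>j\<in>S. (M i j)\<^sup>2) \<le> (\<Sum>i\<in>S. \<Sum>j\<in>S. 1 / 2 * M i j)"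
      by (intro sum_mono)
    also have "\<dots> = 2" using rows S by (simp flip: sum_divide_distrib)
    also have "2 < 1 + 2 * (cmod z)\<^sup>2"
      using power_strict_mono[OF y(1), of 2] unfolding z cmod_power2 by (simp add: power2_eq_square)
    also have "\<dots> \<le> (\<Sum>i\<in>S. \<Sum>j\<in>S. (M i j)\<^sup>2)"
      using Frobenius_ge_nonreal_eigenvalue[OF fin eig nz rows cols] y(1) by (simp add: z)
    finally show False by simp
  qed
  then obtain i0 j0 where ij0: "i0 \<in> S" "j0 \<in> S" "1 / 2 < M i0 j0" by blast
  define a where "a = M i0 j0"
  have big: "1 / 2 < a" using ij0 by (simp add: a_def)
  have "\<exists>j\<in>S. M i j = a" if "i \<in> S" for i
  proof -
    have "a \<in># image_mset (M i0) (mset_set S)" using ij0 fin by (auto simp: a_def)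
    then show ?thesis using perm[OF ij0(1) that] fin by auto
  qed
  then obtain \<pi> where \<pi>: "\<And>i. i \<in> S \<Longrightarrow> \<pi> i \<in> S" "\<And>i. i \<in> S \<Longrightarrow> M i (\<pi> i) = a"
    by metis
  have inj: "i = k" if "i \<in> S" "k \<in> S" "\<pi> i = \<pi> k" for i k
  proof (rule ccontr)
    assume "i \<noteq> k"
    then have "a + a = (\<Sum>l\<in>{i, k}. M l (\<pi> i))" using \<pi>(2)[of i] \<pi>(2)[of k] that by simp
    also have "\<dots> \<le> (\<Sum>l\<in>S. M l (\<pi> i))"
      using that fin nonneg \<pi> by (intro sum_mono2) auto
    also have "\<dots> = 1" using cols \<pi> that by simp
    finally show False using big by simp
  qed
  show False
  proof (cases "\<forall>i\<in>S. \<pi> (\<pi> i) = i")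
    case True
    then have "\<bar>Im z\<bar> \<le> 1 - a"
      using \<pi> by (intro Im_eigenvalue_le_of_involution[where \<pi> = \<pi>, OF fin eig nz rows cols nonneg]) auto
    then show False using y(1) big by (simp add: z)
  next
    case False
    then obtain p where p: "p \<in> S" "\<pi> (\<pi> p) \<noteq> p" by blast
    define q r where "q = \<pi> p" and "r = \<pi> q"
    have \<pi>pq: "\<pi> p = q" "\<pi> q = r" by (simp_all add: q_def r_def)
    have qr: "q \<in> S" "r \<in> S" using p(1) \<pi>(1) \<pi>pq by metis+
    have dist: "p \<noteq> q" "r \<noteq> p" "q \<noteq> r"
      using p \<pi>pq inj[OF p(1) qr(1)] by metis+
    have "card (S - {p, q, r}) = card S - card {p, q, r}"
      using p(1) qr by (intro card_Diff_subset) auto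
    also have "\<dots> = 1" using S dist by simp
    finally obtain s where "S - {p, q, r} = {s}" by (metis card_1_singletonE)
    then have s: "S = {p, q, r, s}" "s \<in> S" "s \<notin> {p, q, r}" using p(1) qr by blast+
    have neq: "\<pi> r \<noteq> q" "\<pi> r \<noteq> r" "\<pi> s \<noteq> q" "\<pi> s \<noteq> r" "\<pi> r \<noteq> \<pi> s"
      using inj[OF qr(2) p(1)] inj[OF qr(2) qr(1)] inj[OF s(2) p(1)] inj[OF s(2) qr(1)]
        inj[OF qr(2) s(2)] s(3) dist \<pi>pq by force+
    have "\<pi> r \<in> {p, q, r, s}" "\<pi> s \<in> {p, q, r, s}"
      using \<pi>(1)[OF qr(2)] \<pi>(1)[OF s(2)] s(1) by auto
    with neq have "(\<pi> r = s \<and> \<pi> s = p) \<or> (\<pi> r = p \<and> \<pi> s = s)" by auto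
    then have cycle: "(M r s = a \<and> M s p = a) \<or> (M r p = a \<and> M s s = a)"
      using \<pi>(2)[OF qr(2)] \<pi>(2)[OF s(2)] by metis
    have Ma: "M p q = a" "M q r = a"
      using \<pi>(2)[OF p(1)] \<pi>(2)[OF qr(1)] \<pi>pq by simp_all
    have "distinct [p, q, r, s]" using s(3) dist by auto
    from dominant_three_or_four_cycle_contradiction[OF s(1) this eig nz rows cols nonneg
        perm[OF _ p(1)] Ma cycle big z _ y(2)] y(1)
    show False by simp
  qed
qed

theorem theorem3p11:
  fixes y :: real and A :: "real mat"
  assumes "1 / 2 < y" and "y < sqrt 3 / 2"
    and "A \<in> carrier_mat 4 4"
    and "permutative_doubly_stochastic A"
  shows "\<not> eigenvalue (map_mat complex_of_real A) (- (1 / 2) + complex_of_real y * \<i>)"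
proof
  let ?z = "- (1 / 2) + complex_of_real y * \<i>"
  let ?M = "\<lambda>i j. A $$ (i, j)"
  let ?S = "{..<4::nat}"
  have dim [simp]: "dim_row A = 4" "dim_col A = 4" using assms(3) by auto
  have pds: "permutative A" "doubly_stochastic A"
    using assms(4) by (auto simp: permutative_doubly_stochastic_def)
  assume "eigenvalue (map_mat complex_of_real A) ?z"
  then obtain v where v: "v \<in> carrier_vec 4" "v \<noteq> 0\<^sub>v 4"
      "map_mat complex_of_real A *\<^sub>v v = ?z \<cdot>\<^sub>v v"
    by (auto simp: eigenvalue_def eigenvector_def)
  have eig: "(\<Sum>j\<in>?S. complex_of_real (?M i j) * v $ j) = ?z * v $ i" if "i \<in> ?S" for i
    using arg_cong[OF v(3), of "\<lambda>w. w $ i"] that v(1)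
    by (simp add: scalar_prod_def atLeast0LessThan)
  have row0: "image_mset (?M i) (mset_set ?S) = image_mset (?M 0) (mset_set ?S)" if "i \<in> ?S" for i
  proof -
    obtain p where p: "p permutes ?S" "\<forall>j<4. ?M i j = ?M 0 (p j)"
      using pds(1) \<open>i \<in> ?S\<close> by (auto simp: permutative_def)
    have "image_mset (?M i) (mset_set ?S) = image_mset (?M 0) (image_mset p (mset_set ?S))"
      using p(2) by (simp add: multiset.map_comp o_def) (auto intro!: image_mset_cong)
    also have "image_mset p (mset_set ?S) = mset_set ?S"
      using p(1) by (metis image_mset_mset_set permutes_image permutes_inj_on)
    finally show ?thesis .
  qed
  have "y\<^sup>2 < (sqrt 3 / 2)\<^sup>2"
    using assms(1,2) by (intro power_strict_mono) auto
  then have y2: "y\<^sup>2 < 3 / 4" by (simp add: power_divide)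
  have rows: "(\<Sum>j\<in>?S. ?M i j) = 1" and cols: "(\<Sum>j\<in>?S. ?M j i) = 1" if "i \<in> ?S" for i
    using pds(2) that by (simp_all add: doubly_stochastic_def)
  have nonneg: "0 \<le> ?M i j" if "i \<in> ?S" "j \<in> ?S" for i j
    using pds(2) that by (simp add: doubly_stochastic_def)
  have perm: "image_mset (?M i) (mset_set ?S) = image_mset (?M k) (mset_set ?S)"
    if "i \<in> ?S" "k \<in> ?S" for i k
    using row0[OF that(1)] row0[OF that(2)] by metis
  have "v $ i = 0" if "i \<in> ?S" for i
    by (rule permutative_four_no_eigenvalue[OF _ eig rows cols nonneg perm refl assms(1) y2 that]) simp
  then have "v = 0\<^sub>v 4" using v(1) by (intro eq_vecI) simp_all
  with v(2) show False by simp
qed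

end
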